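(* Let $n,m\ge1$, let $t_0<T$ be real numbers, let $U\subseteq\mathbb{R}^m$ be nonempty, and let $f=(f_1,\dots,f_n)^T:\mathbb{R}^n\times U\times[t_0,T]\to\mathbb{R}^n$ and $F:\mathbb{R}^n\times U\times[t_0,T]\to\mathbb{R}$ be continuous and differentiable with respect to $x\in\mathbb{R}^n$. Assume there is a modulus $\omega$ such that for each $t\in[t_0,T]$ and each of the functions $\phi(x,u)=f_1(x,u,t),\dots,f_n(x,u,t),F(x,u,t)$, $$|\phi(x,u)-\phi(y,u)|\le\omega(R,\|x-y\|)\qquad\text{for all }R>0,\ x,y\in B_R(\mathbb{R}^n),\ u\in U.$$ Let $\mathscr{H}(x,p,u,t):=\sum_{i=1}^np_if_i(x,u,t)-F(x,u,t)$, $H(x,p,t):=\sup_{u\in U}\mathscr{H}(x,p,u,t)$ and $A(x,p,t):=\{u\in U:\mathscr{H}(x,p,u,t)=H(x,p,t)\}$. Then for all $x,p\in\mathbb{R}^n$ and $t\in[t_0,T]$: (I) $H(x,\cdot,t)$ is convex. (II) If $A(x,p,t)\ne\emptyset$ and $H(x,\cdot,t)$ is differentiable at $p$, then $u\mapsto f(x,u,t)$ is constant on $A(x,p,t)$. If $A(x,p,t)\neq\emptyset$ and $H(\cdot,p,t)$ is differentiable at $x$, then $$u\mapsto\sum_{i=1}^np_i\frac{\partial f_i}{\partial x}(x,u,t)-\frac{\partial F}{\partial x}(x,u,t)$$ is constant on $A(x,p,t)$.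
   Context: Notation: $\mathbb{R}_+=[0,+\infty)$; $B_R(\mathbb{R}^n)$ is the open ball of radius $R$ centered at $0$. A modulus is a function $\omega:\mathbb{R}_+\times\mathbb{R}_+\to\mathbb{R}_+$ with $\omega(r,d)\le\omega(R,D)$ whenever $r\le R$, $d\le D$, and $\lim_{D\to0+}\omega(R,D)=0$ for every $R>0$. The Hamiltonian $H:\mathbb{R}^n\times\mathbb{R}^n\times[t_0,T]\to\mathbb{R}$ is taken to be real-valued (the supremum is finite everywhere). $\frac{\partial f_i}{\partial x}$ and $\frac{\partial F}{\partial x}$ denote gradients in $x$. *)

theory Defs
  imports "HOL-Analysis.Analysis"
begin

text \<open>Moduli are functions on \<open>[0,\<infinity>) \<times> [0,\<infinity>)\<close>; their values at negative arguments are
  unconstrained and irrelevant.\<close>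

definition modulus :: "(real \<Rightarrow> real \<Rightarrow> real) \<Rightarrow> bool" where
  "modulus \<omega> \<longleftrightarrow>
     (\<forall>R\<ge>0. \<forall>D\<ge>0. 0 \<le> \<omega> R D) \<and>
     (\<forall>r R d D. 0 \<le> r \<longrightarrow> r \<le> R \<longrightarrow> 0 \<le> d \<longrightarrow> d \<le> D \<longrightarrow> \<omega> r d \<le> \<omega> R D) \<and>
     (\<forall>R>0. ((\<lambda>D. \<omega> R D) \<longlongrightarrow> 0) (at_right 0))"

text \<open>Meaningful only where the function is differentiable; there the gradient is unique.\<close>

definition gradient :: "('a::euclidean_space \<Rightarrow> real) \<Rightarrow> 'a \<Rightarrow> 'a" where
  "gradient g x = (THE v. GDERIV g x :> v)"

definition pre_hamiltonian ::
  "(real^'n \<Rightarrow> real^'m \<Rightarrow> real \<Rightarrow> real^'n) \<Rightarrow> (real^'n \<Rightarrow> real^'m \<Rightarrow> real \<Rightarrow> real) \<Rightarrow>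
   real^'n \<Rightarrow> real^'n \<Rightarrow> real^'m \<Rightarrow> real \<Rightarrow> real" where
  "pre_hamiltonian f F x p u t = (\<Sum>i\<in>UNIV. p $ i * f x u t $ i) - F x u t"

text \<open>The supremum is taken in the reals, so it is the intended one only when \<open>U\<close> is nonempty
  and the family is bounded above.\<close>

definition hamiltonian ::
  "(real^'m) set \<Rightarrow> (real^'n \<Rightarrow> real^'m \<Rightarrow> real \<Rightarrow> real^'n) \<Rightarrow> (real^'n \<Rightarrow> real^'m \<Rightarrow> real \<Rightarrow> real) \<Rightarrow>
   real^'n \<Rightarrow> real^'n \<Rightarrow> real \<Rightarrow> real" where
  "hamiltonian U f F x p t = (SUP u\<in>U. pre_hamiltonian f F x p u t)"

definition maximizers ::
  "(real^'m) set \<Rightarrow> (real^'n \<Rightarrow> real^'m \<Rightarrow> real \<Rightarrow> real^'n) \<Rightarrow> (real^'n \<Rightarrow> real^'m \<Rightarrow> real \<Rightarrow> real) \<Rightarrow>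
   real^'n \<Rightarrow> real^'n \<Rightarrow> real \<Rightarrow> (real^'m) set" where
  "maximizers U f F x p t = {u \<in> U. pre_hamiltonian f F x p u t = hamiltonian U f F x p t}"

end

theory Submission
  imports Defs
begin

text \<open>
  This is the envelope principle. For a fixed maximizing control \<open>u\<close>, the supremum over all
  controls lies above the function belonging to \<open>u\<close> and touches it at the base point. The
  difference of the two functions therefore has a minimum there, and if both are
  differentiable at that point, their gradients at it agree (\<open>GDERIV_SUP_at_maximizer\<close>). The gradient of the supremum
  does not depend on \<open>u\<close>, so the gradient of the member belonging to \<open>u\<close> is the same for every
  maximizer \<open>u\<close>. In the variable \<open>p\<close> this gradient is \<open>f(x,u,t)\<close>, because the pre-Hamiltonian is
  affine in \<open>p\<close> with slope \<open>f(x,u,t)\<close>; in the variable \<open>x\<close> it is the combination of gradients of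
  \<open>f\<^sub>i\<close> and \<open>F\<close> in the statement. Convexity in \<open>p\<close> holds because a supremum of affine functions
  is convex.
\<close>

lemma GDERIV_unique:
  assumes "GDERIV g x :> v" "GDERIV g x :> w"
  shows "v = w"
proof -
  have "(\<lambda>h. h \<bullet> v) = (\<lambda>h. h \<bullet> w)"
    using assms unfolding gderiv_def by (rule has_derivative_unique)
  then show ?thesis
    by (metis vector_eq_ldot)
qed

lemma gradient_eqI:
  assumes "GDERIV g x :> v"
  shows "gradient g x = v"
  unfolding gradient_def using assms by (blast intro: GDERIV_unique)

lemma GDERIV_gradient:
  fixes g :: "'a::euclidean_space \<Rightarrow> real"
  assumes "g differentiable (at x)"
  shows "GDERIV g x :> gradient g x"
proof -
  obtain g' where g': "(g has_derivative g') (at x)"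
    using assms unfolding differentiable_def by blast
  \<comment> \<open>The Riesz representative of a functional is the value of its adjoint at \<open>1\<close>.\<close>
  have "g' = (\<lambda>h. h \<bullet> adjoint g' 1)"
    using adjoint_works[OF has_derivative_linear[OF g'], of _ 1] by (simp add: fun_eq_iff)
  with g' have "GDERIV g x :> adjoint g' 1"
    unfolding gderiv_def by metis
  then show ?thesis
    using gradient_eqI by metis
qed

lemma GDERIV_sum:
  assumes "\<And>i. i \<in> I \<Longrightarrow> GDERIV (g i) x :> v i"
  shows "GDERIV (\<lambda>y. \<Sum>i\<in>I. g i y) x :> (\<Sum>i\<in>I. v i)"
  using assms unfolding gderiv_def inner_sum_right by (rule has_derivative_sum)

text \<open>The difference of two functions that touch has an extremum at the point of contact, where
  its derivative must vanish.\<close>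

lemma GDERIV_eq_if_touching:
  assumes "GDERIV g x :> v" "GDERIV h x :> w"
    and "\<And>y. g y \<le> h y" "g x = h x"
  shows "v = w"
proof -
  have "((\<lambda>y. h y - g y) has_derivative (\<lambda>k. k \<bullet> (w - v))) (at x)"
    using GDERIV_diff[OF assms(2,1)] unfolding gderiv_def .
  moreover have "eventually (\<lambda>y. h x - g x \<le> h y - g y) (at x)"
    using assms(3,4) by simp
  ultimately have "(\<lambda>k. k \<bullet> (w - v)) = (\<lambda>k. 0)"
    by (rule has_derivative_local_min)
  then have "(w - v) \<bullet> (w - v) = 0"
    by metis
  then show ?thesis by simp
qed

text \<open>The supremum lies above \<open>\<phi> u\<close> and touches it at \<open>x\<close>. Its gradient, unlike \<open>v\<close>, makes no
  reference to \<open>u\<close>, and so any two maximizers have the same \<open>v\<close>.\<close>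

lemma GDERIV_SUP_at_maximizer:
  fixes \<phi> :: "'b \<Rightarrow> 'a::euclidean_space \<Rightarrow> real"
  assumes "u \<in> U" "\<phi> u x = (SUP w\<in>U. \<phi> w x)"
    and "\<And>y. bdd_above ((\<lambda>w. \<phi> w y) ` U)"
    and "(\<lambda>y. SUP w\<in>U. \<phi> w y) differentiable (at x)"
    and "GDERIV (\<phi> u) x :> v"
  shows "v = gradient (\<lambda>y. SUP w\<in>U. \<phi> w y) x"
  using assms(5) GDERIV_gradient[OF assms(4)]
proof (rule GDERIV_eq_if_touching)
  show "\<phi> u y \<le> (SUP w\<in>U. \<phi> w y)" for y
    using assms(1,3) by (rule cSUP_upper)
qed (fact assms(2))

lemma convex_on_SUP:
  assumes "U \<noteq> {}" "convex S"
    and "\<And>u. u \<in> U \<Longrightarrow> convex_on S (\<phi> u)"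
    and "\<And>y. y \<in> S \<Longrightarrow> bdd_above ((\<lambda>u. \<phi> u y) ` U)"
  shows "convex_on S (\<lambda>y. SUP u\<in>U. \<phi> u y)"
proof (rule convex_onI)
  fix s :: real and x y
  assume s: "0 < s" "s < 1" and xy: "x \<in> S" "y \<in> S"
  show "(SUP u\<in>U. \<phi> u ((1 - s) *\<^sub>R x + s *\<^sub>R y))
          \<le> (1 - s) * (SUP u\<in>U. \<phi> u x) + s * (SUP u\<in>U. \<phi> u y)"
  proof (rule cSUP_least[OF assms(1)])
    fix u assume u: "u \<in> U"
    have "\<phi> u ((1 - s) *\<^sub>R x + s *\<^sub>R y) \<le> (1 - s) * \<phi> u x + s * \<phi> u y"
      using convex_onD[OF assms(3)[OF u]] s xy by simp
    also have "\<dots> \<le> (1 - s) * (SUP u\<in>U. \<phi> u x) + s * (SUP u\<in>U. \<phi> u y)"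
      using s u xy assms(4) by (intro add_mono mult_left_mono cSUP_upper) auto
    finally show "\<phi> u ((1 - s) *\<^sub>R x + s *\<^sub>R y) \<le> \<dots>" .
  qed
qed (fact assms(2))

lemma pre_hamiltonian_eq_inner: "pre_hamiltonian f F x p u t = p \<bullet> f x u t - F x u t"
  by (simp add: pre_hamiltonian_def inner_vec_def)

lemma convex_on_pre_hamiltonian: "convex_on UNIV (\<lambda>q. pre_hamiltonian f F x q u t)"
  by (rule convex_onI) (simp_all add: pre_hamiltonian_eq_inner inner_add_left algebra_simps)

lemma GDERIV_pre_hamiltonian_costate: "GDERIV (\<lambda>q. pre_hamiltonian f F x q u t) p :> f x u t"
  unfolding gderiv_def pre_hamiltonian_eq_inner by (auto intro!: derivative_eq_intros)

lemma GDERIV_pre_hamiltonian_state: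
  fixes f :: "real^'n \<Rightarrow> real^'m \<Rightarrow> real \<Rightarrow> real^'n"
  assumes "(\<lambda>y. f y u t) differentiable (at x)" "(\<lambda>y. F y u t) differentiable (at x)"
  shows "GDERIV (\<lambda>y. pre_hamiltonian f F y p u t) x :>
           (\<Sum>i\<in>UNIV. p $ i *\<^sub>R gradient (\<lambda>y. f y u t $ i) x) - gradient (\<lambda>y. F y u t) x"
proof -
  have "GDERIV (\<lambda>y. p $ i * f y u t $ i) x :> p $ i *\<^sub>R gradient (\<lambda>y. f y u t $ i) x" for i
  proof -
    have "(\<lambda>y. f y u t $ i) differentiable (at x)"
      using assms(1) bounded_linear.has_derivative[OF bounded_linear_vec_nth]
      unfolding differentiable_def by blast
    from GDERIV_mult[OF GDERIV_const GDERIV_gradient[OF this], of "p $ i"] show ?thesis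
      by simp
  qed
  then show ?thesis
    unfolding pre_hamiltonian_def
    by (intro GDERIV_diff GDERIV_sum GDERIV_gradient assms(2))
qed

theorem proposition4p1:
  fixes t0 T :: real
    and U :: "(real^'m) set"
    and f :: "real^'n \<Rightarrow> real^'m \<Rightarrow> real \<Rightarrow> real^'n"
    and F :: "real^'n \<Rightarrow> real^'m \<Rightarrow> real \<Rightarrow> real"
    and \<omega> :: "real \<Rightarrow> real \<Rightarrow> real"
  assumes "t0 < T"
    and "U \<noteq> {}"
    and "continuous_on (UNIV \<times> U \<times> {t0..T}) (\<lambda>(x, u, t). f x u t)"
    and "continuous_on (UNIV \<times> U \<times> {t0..T}) (\<lambda>(x, u, t). F x u t)"
    and "\<And>x u t. u \<in> U \<Longrightarrow> t \<in> {t0..T} \<Longrightarrow> (\<lambda>y. f y u t) differentiable (at x)"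
    and "\<And>x u t. u \<in> U \<Longrightarrow> t \<in> {t0..T} \<Longrightarrow> (\<lambda>y. F y u t) differentiable (at x)"
    and "modulus \<omega>"
    and "\<And>i R x y u t. t \<in> {t0..T} \<Longrightarrow> R > 0 \<Longrightarrow> x \<in> ball 0 R \<Longrightarrow> y \<in> ball 0 R \<Longrightarrow> u \<in> U \<Longrightarrow>
           \<bar>f x u t $ i - f y u t $ i\<bar> \<le> \<omega> R (norm (x - y))"
    and "\<And>R x y u t. t \<in> {t0..T} \<Longrightarrow> R > 0 \<Longrightarrow> x \<in> ball 0 R \<Longrightarrow> y \<in> ball 0 R \<Longrightarrow> u \<in> U \<Longrightarrow>
           \<bar>F x u t - F y u t\<bar> \<le> \<omega> R (norm (x - y))"
    and "\<And>x p t. t \<in> {t0..T} \<Longrightarrow> bdd_above ((\<lambda>u. pre_hamiltonian f F x p u t) ` U)"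
  shows "\<forall>x p. \<forall>t\<in>{t0..T}.
      convex_on UNIV (\<lambda>q. hamiltonian U f F x q t) \<and>
      (maximizers U f F x p t \<noteq> {} \<longrightarrow>
       (\<lambda>q. hamiltonian U f F x q t) differentiable (at p) \<longrightarrow>
       (\<lambda>u. f x u t) constant_on maximizers U f F x p t) \<and>
      (maximizers U f F x p t \<noteq> {} \<longrightarrow>
       (\<lambda>y. hamiltonian U f F y p t) differentiable (at x) \<longrightarrow>
       (\<lambda>u. (\<Sum>i\<in>UNIV. p $ i *\<^sub>R gradient (\<lambda>y. f y u t $ i) x) - gradient (\<lambda>y. F y u t) x)
         constant_on maximizers U f F x p t)"
proof (intro allI ballI conjI impI)
  fix x p :: "real^'n" and t :: real
  assume t: "t \<in> {t0..T}"
  let ?A = "maximizers U f F x p t"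
  have A: "u \<in> U" "pre_hamiltonian f F x p u t = (SUP w\<in>U. pre_hamiltonian f F x p w t)"
    if "u \<in> ?A" for u
    using that by (simp_all add: maximizers_def hamiltonian_def)
  show "convex_on UNIV (\<lambda>q. hamiltonian U f F x q t)"
    unfolding hamiltonian_def
    by (intro convex_on_SUP assms(2,10) convex_UNIV convex_on_pre_hamiltonian t)
  show "(\<lambda>u. f x u t) constant_on ?A"
    if "(\<lambda>q. hamiltonian U f F x q t) differentiable (at p)"
    unfolding constant_on_def
  proof (intro exI ballI)
    fix u assume u: "u \<in> ?A"
    show "f x u t = gradient (\<lambda>q. SUP w\<in>U. pre_hamiltonian f F x q w t) p"
      by (rule GDERIV_SUP_at_maximizer[where \<phi> = "\<lambda>w q. pre_hamiltonian f F x q w t",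
            OF A[OF u] assms(10)[OF t] that[unfolded hamiltonian_def]
               GDERIV_pre_hamiltonian_costate])
  qed
  show "(\<lambda>u. (\<Sum>i\<in>UNIV. p $ i *\<^sub>R gradient (\<lambda>y. f y u t $ i) x) - gradient (\<lambda>y. F y u t) x)
          constant_on ?A"
    if "(\<lambda>y. hamiltonian U f F y p t) differentiable (at x)"
    unfolding constant_on_def
  proof (intro exI ballI)
    fix u assume u: "u \<in> ?A"
    have "GDERIV (\<lambda>y. pre_hamiltonian f F y p u t) x :>
        (\<Sum>i\<in>UNIV. p $ i *\<^sub>R gradient (\<lambda>y. f y u t $ i) x) - gradient (\<lambda>y. F y u t) x"
      by (intro GDERIV_pre_hamiltonian_state assms(5,6) A(1)[OF u] t)
    then show "(\<Sum>i\<in>UNIV. p $ i *\<^sub>R gradient (\<lambda>y. f y u t $ i) x) - gradient (\<lambda>y. F y u t) x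
            = gradient (\<lambda>y. SUP w\<in>U. pre_hamiltonian f F y p w t) x"
      by (rule GDERIV_SUP_at_maximizer[where \<phi> = "\<lambda>w y. pre_hamiltonian f F y p w t",
            OF A[OF u] assms(10)[OF t] that[unfolded hamiltonian_def]])
  qed
qed

end
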